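(* Let $n\geq 2$. The primary facet-defining inequalities of the interval order polytope $\mathrm{P}_{\mathrm{IO}}^{n}$ are exactly the nonnegativity inequalities $-x_{ij}\leq 0$ (for $(i,j)\in A_n$) and the inequalities $$\sum_{a\in A}x_a-\sum_{b\in B}x_b\leq 1$$ (with $A,B$ disjoint subsets of $A_n$) for which $|A|\geq 2$, Conditions C1, C2 and C3 hold, and moreover $B$ is $A$[C2--C3]-forced.
   Context: $[n]=\{1,\dots,n\}$ and $A_n=\{(i,j) : i,j\in[n],\ i\neq j\}$. We write $x_{ij}$ for the coordinate $x_{(i,j)}$ of $x\in\mathbb{R}^{A_n}$. A (strict) partial order on $[n]$ is an irreflexive, asymmetric, transitive relation. An interval order on $[n]$ is a partial order $S$ for which there exist maps $f,g:[n]\to\mathbb{R}$ such that $(i,j)\in S$ if and only if $g(i)<f(j)$. The characteristic vector $\chi^S\in\mathbb{R}^{A_n}$ of $S$ has $\chi^S_{ij}=1$ if $(i,j)\in S$ and $0$ otherwise. The interval order polytope is $\mathrm{P}_{\mathrm{IO}}^{n}=\operatorname{conv}\{\chi^S : S\text{ an interval order on }[n]\}\subseteq\mathbb{R}^{A_n}$; it has full dimension $n(n-1)$. A linear inequality is valid for a polytope $P$ if all points of $P$ satisfy it; it is facet-defining if it is valid and the set of points of $P$ satisfying it with equality is a face of dimension $\dim(P)-1$. A linear inequality on $\mathbb{R}^{A_n}$ is primary when its coefficients, including the independent term, take only the values $-1,0,1$, i.e. when it has the form $\sum_{a\in A}x_a-\sum_{b\in B}x_b\leq\beta$ with $\beta\in\{-1,0,1\}$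 and $A,B$ disjoint subsets of $A_n$, not both empty. Conditions on $A,B\subseteq A_n$: C1: for any distinct pairs $(i,j),(k,l)\in A$, there holds $i\neq k$ and $j\neq l$. C2: for any $(i,j),(k,l)\in A$ with $i,j,k,l$ distinct, there holds $(i,l)\in B$. C3: for any $(i,j),(j,k)\in A$ with $i,j,k$ distinct, there holds $(i,k)\in B$. $B$ is $A$[C2--C3]-forced when it consists exactly of the pairs whose presence is required by C2 and C3, i.e. for all $(i,l)\in A_n$: $(i,l)\in B$ if and only if there exist $(i,j),(k,l)\in A$ with $i,j,k,l$ distinct, or there exist $(i,j),(j,l)\in A$ with $i,j,l$ distinct. *)

theory Defs
  imports "HOL-Analysis.Analysis"
begin

text \<open>
  The ground set \<open>[n]\<close> is an arbitrary finite type \<open>'v\<close> with \<open>n = CARD('v)\<close> elements.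
  The space \<open>\<real>\<^bsup>A\<^esup>\<close> for \<open>A = arcs\<close> is identified with the coordinate subspace of
  \<^typ>\<open>real ^ ('v \<times> 'v)\<close> on which all diagonal coordinates vanish. Interval orders are
  irreflexive, so their characteristic vectors lie in this subspace; faces and \<^const>\<open>aff_dim\<close>
  of the polytope are intrinsic and hence the same as in \<open>\<real>\<^bsup>A\<^esup>\<close>.
\<close>

definition arcs :: "('v \<times> 'v) set" where
  "arcs = {(i, j). i \<noteq> j}"

definition interval_order :: "('v \<times> 'v) set \<Rightarrow> bool" where
  "interval_order S \<longleftrightarrow>
     irrefl S \<and> asym S \<and> trans S \<and>
     (\<exists>f g :: 'v \<Rightarrow> real. \<forall>i j. (i, j) \<in> S \<longleftrightarrow> g i < f j)"

definition char_vec :: "('v::finite \<times> 'v) set \<Rightarrow> real ^ ('v \<times> 'v)" where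
  "char_vec S = (\<chi> a. if a \<in> S then 1 else 0)"

definition interval_order_polytope :: "(real ^ ('v::finite \<times> 'v)) set" where
  "interval_order_polytope = convex hull {char_vec S | S. interval_order S}"

text \<open>
  The inequality \<open>l x \<le> \<beta>\<close> is facet-defining for \<open>P\<close>. The library predicate \<open>facet_of\<close>
  additionally requires the face to be nonempty, which is automatic if \<open>P\<close> has positive dimension.
\<close>

definition facet_defining :: "('a::euclidean_space \<Rightarrow> real) \<Rightarrow> real \<Rightarrow> 'a set \<Rightarrow> bool" where
  "facet_defining l \<beta> P \<longleftrightarrow>
     linear l \<and> (\<forall>x\<in>P. l x \<le> \<beta>) \<and> {x \<in> P. l x = \<beta>} facet_of P"

definition primary_lhs ::
    "('v::finite \<times> 'v) set \<Rightarrow> ('v \<times> 'v) set \<Rightarrow> real ^ ('v \<times> 'v) \<Rightarrow> real" where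
  "primary_lhs A B x = (\<Sum>a\<in>A. x $ a) - (\<Sum>b\<in>B. x $ b)"

text \<open>
  A primary inequality \<open>primary_lhs A B x \<le> \<beta>\<close> is encoded by \<open>(A, B, \<beta>)\<close>. As \<open>A\<close> and \<open>B\<close> are
  disjoint, this triple is determined by the coefficients and the independent term.
\<close>

definition primary :: "('v \<times> 'v) set \<Rightarrow> ('v \<times> 'v) set \<Rightarrow> real \<Rightarrow> bool" where
  "primary A B \<beta> \<longleftrightarrow>
     A \<subseteq> arcs \<and> B \<subseteq> arcs \<and> A \<inter> B = {} \<and> (A \<noteq> {} \<or> B \<noteq> {}) \<and> \<beta> \<in> {-1, 0, 1}"

definition C1 :: "('v \<times> 'v) set \<Rightarrow> bool" where
  "C1 A \<longleftrightarrow>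
     (\<forall>i j k l. (i, j) \<in> A \<and> (k, l) \<in> A \<and> (i, j) \<noteq> (k, l) \<longrightarrow> i \<noteq> k \<and> j \<noteq> l)"

definition C2 :: "('v \<times> 'v) set \<Rightarrow> ('v \<times> 'v) set \<Rightarrow> bool" where
  "C2 A B \<longleftrightarrow>
     (\<forall>i j k l. (i, j) \<in> A \<and> (k, l) \<in> A \<and> distinct [i, j, k, l] \<longrightarrow> (i, l) \<in> B)"

definition C3 :: "('v \<times> 'v) set \<Rightarrow> ('v \<times> 'v) set \<Rightarrow> bool" where
  "C3 A B \<longleftrightarrow>
     (\<forall>i j k. (i, j) \<in> A \<and> (j, k) \<in> A \<and> distinct [i, j, k] \<longrightarrow> (i, k) \<in> B)"

definition C2_C3_forced :: "('v \<times> 'v) set \<Rightarrow> ('v \<times> 'v) set \<Rightarrow> bool" where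
  "C2_C3_forced A B \<longleftrightarrow>
     (\<forall>(i, l) \<in> arcs. (i, l) \<in> B \<longleftrightarrow>
        (\<exists>j k. (i, j) \<in> A \<and> (k, l) \<in> A \<and> distinct [i, j, k, l]) \<or>
        (\<exists>j. (i, j) \<in> A \<and> (j, l) \<in> A \<and> distinct [i, j, l]))"

end

theory Submission
  imports Defs
begin

text \<open>
  Everything rests on one small family of interval orders, the staircases
  \<open>{(i, j), (k, l), (i, l)}\<close>. They contain the orders with one arc (\<open>i = k\<close> and \<open>j = l\<close>), the
  two arcs with a common tail or head, the chain with three elements (\<open>j = k\<close>) and the poset N.
  Conditions C1, C2 and C3 say together that staircases satisfy the inequality: if \<open>(i, j)\<close> and
  \<open>(k, l)\<close> lie in \<open>A\<close>, the staircase has the value 2 unless \<open>(i, l)\<close> lies in \<open>B\<close>. Under C1,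
  moreover, C2 and C3 merge into one requirement, so that the forced set depends on \<open>A\<close> only
  and is called \<open>forced A\<close> below.

  If C1 holds, the inequality with \<open>B = forced A\<close> is valid (\<open>forced_inequality_at_order\<close>): among
  the arcs of \<open>A\<close> in an interval order \<open>S\<close>, let \<open>(i, j)\<close> be one whose tail interval ends first.
  Then \<open>i\<close> also precedes the head \<open>l\<close> of every other such arc, and each \<open>(i, l)\<close> is a forced
  pair in \<open>S\<close>. If moreover \<open>A\<close> has at least two elements, the inequality defines a facet
  (\<open>tight_unit_vectors_span\<close>): its tight vertices span the whole space, because each unit vector
  is what remains of a tight staircase after subtraction of unit vectors already known to lie in
  the span. The right-hand side is 1, so a face whose linear span is the whole space has
  codimension one in the polytope.

  Conversely, a facet is contained in no other proper face (\<open>facet_maximal\<close>). A facet-defining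
  primary inequality with right-hand side 0 has no positive coefficient, since single arcs are
  interval orders; for each negative coefficient \<open>b\<close> its
  face then lies in \<open>x\<^sub>b = 0\<close> and equals that face, so there is only one. The right-hand
  side \<open>-1\<close> is excluded by the origin, the vector of the empty order. If the right-hand side is 1,
  staircases give C1 and \<open>forced A \<subseteq> B\<close>. An additional \<open>b \<in> B\<close> would put the
  face inside \<open>x\<^sub>b = 0\<close>, because the inequality with \<open>forced A\<close> is already valid; and if
  \<open>A = {(i, j)}\<close>, the face would lie in that of \<open>x\<^sub>i\<^sub>j + x\<^sub>j\<^sub>i \<le> 1\<close>. Both contradict maximality.
\<close>

section \<open>Interval orders\<close>

text \<open>
  When \<open>[f i, g i]\<close> is a genuine interval for each \<open>i\<close>, being strictly to the left is
  automatically a partial order, so only the representation has to be given.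
\<close>

lemma interval_orderI:
  fixes f g :: "'v \<Rightarrow> real"
  assumes rep: "\<And>i j. (i, j) \<in> S \<longleftrightarrow> g i < f j" and le: "\<And>i. f i \<le> g i"
  shows "interval_order S"
proof -
  have "irrefl S"
    using le by (auto simp: irrefl_def rep not_less)
  moreover have "trans S"
  proof (rule transI)
    fix x y z assume "(x, y) \<in> S" "(y, z) \<in> S"
    then show "(x, z) \<in> S" using le[of y] by (simp add: rep)
  qed
  moreover have "asym S"
  proof (rule asymI)
    fix x y assume "(x, y) \<in> S"
    then show "(y, x) \<notin> S" using le[of x] le[of y] by (simp add: rep)
  qed
  ultimately show ?thesis
    unfolding interval_order_def using rep by blast
qed

lemma interval_order_empty: "interval_order {}"
  by (rule interval_orderI[where f = "\<lambda>_. 0" and g = "\<lambda>_. 0"]) auto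

definition staircase :: "'v \<Rightarrow> 'v \<Rightarrow> 'v \<Rightarrow> 'v \<Rightarrow> ('v \<times> 'v) set" where
  "staircase i j k l = {(i, j), (k, l), (i, l)}"

text \<open>
  The interval of \<open>i\<close> ends at 0, that of \<open>k\<close> at 1, all others at 2; the interval of \<open>j\<close> starts
  at 1, that of \<open>l\<close> at 2, all others at 0. The intended coincidences \<open>i = k\<close>, \<open>j = l\<close> and
  \<open>j = k\<close> are harmless because of the order in which the cases are tested.
\<close>

lemma interval_order_staircase:
  assumes "i \<noteq> j" "i \<noteq> l" "k \<noteq> l"
  shows "interval_order (staircase i j k l)"
  by (rule interval_orderI[where g = "\<lambda>v. if v = i then 0 else if v = k then 1 else 2"
        and f = "\<lambda>v. if v = l then 2 else if v = j then 1 else 0"])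
     (use assms in \<open>auto simp: staircase_def split: if_splits\<close>)

lemma interval_order_singleton:
  assumes "a \<in> arcs"
  shows "interval_order {a}"
proof -
  obtain i j where "a = (i, j)" "i \<noteq> j"
    using assms by (auto simp: arcs_def)
  then show ?thesis
    using interval_order_staircase[of i j j i] by (simp add: staircase_def)
qed

lemma interval_order_subset_arcs: "interval_order S \<Longrightarrow> S \<subseteq> arcs"
  by (auto simp: interval_order_def irrefl_def arcs_def)

section \<open>Faces cut out by valid inequalities\<close>

lemma valid_inequality_face:
  fixes P :: "'a::euclidean_space set" and l :: "'a \<Rightarrow> real"
  assumes "convex P" and l: "linear l" and valid: "\<And>x. x \<in> P \<Longrightarrow> l x \<le> \<beta>"
  shows "{x \<in> P. l x = \<beta>} face_of P"
proof -
  have l_eq: "l x = adjoint l 1 \<bullet> x" for x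
    using adjoint_works[OF l, of x 1] by (simp add: inner_commute)
  have "P \<inter> {x. adjoint l 1 \<bullet> x = \<beta>} face_of P"
    by (rule face_of_Int_supporting_hyperplane_le[OF assms(1)]) (use valid l_eq in simp)
  moreover have "P \<inter> {x. adjoint l 1 \<bullet> x = \<beta>} = {x \<in> P. l x = \<beta>}"
    by (auto simp: l_eq)
  ultimately show ?thesis by simp
qed

text \<open>
  Adding one point to a set raises its affine dimension by at most one, so a proper face that
  spans the polytope together with a single point \<open>v\<close> must be a facet.
\<close>

lemma facet_definingI:
  fixes P :: "'a::euclidean_space set" and l :: "'a \<Rightarrow> real"
  assumes P: "convex P" and l: "linear l" and valid: "\<And>x. x \<in> P \<Longrightarrow> l x \<le> \<beta>"
    and y: "y \<in> P" "l y = \<beta>" and z: "z \<in> P" "l z \<noteq> \<beta>"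
    and hull: "P \<subseteq> affine hull insert v {x \<in> P. l x = \<beta>}"
  shows "facet_defining l \<beta> P"
proof -
  let ?F = "{x \<in> P. l x = \<beta>}"
  have F: "?F face_of P"
    by (rule valid_inequality_face[OF P l valid])
  moreover have "?F \<noteq> P"
    using z by blast
  ultimately have "aff_dim ?F < aff_dim P"
    using face_of_aff_dim_lt[OF P] by blast
  moreover have "aff_dim P \<le> aff_dim (insert v ?F)"
    using aff_dim_subset[OF hull] by (simp only: aff_dim_affine_hull)
  then have "aff_dim P \<le> aff_dim ?F + 1"
    by (auto simp: aff_dim_insert split: if_splits)
  ultimately have "aff_dim ?F = aff_dim P - 1"
    by linarith
  then show ?thesis
    using F y l valid unfolding facet_defining_def facet_of_def by blast
qed

text \<open>
  Used by contradiction: if the facet is contained in the proper face \<open>m x = \<gamma>\<close>, then the two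
  have the same dimension and coincide, so each point \<open>y\<close> of the larger face is tight for \<open>l\<close>.
\<close>

lemma facet_maximal:
  fixes P :: "'a::euclidean_space set" and l m :: "'a \<Rightarrow> real"
  assumes P: "convex P" and facet: "facet_defining l \<beta> P"
    and m: "linear m" and valid: "\<And>x. x \<in> P \<Longrightarrow> m x \<le> \<gamma>"
    and sub: "\<And>x. x \<in> P \<Longrightarrow> l x = \<beta> \<Longrightarrow> m x = \<gamma>"
    and z: "z \<in> P" "m z \<noteq> \<gamma>" and y: "y \<in> P" "m y = \<gamma>"
  shows "l y = \<beta>"
proof (rule ccontr)
  assume "l y \<noteq> \<beta>"
  let ?F = "{x \<in> P. l x = \<beta>}" and ?G = "{x \<in> P. m x = \<gamma>}"
  have F: "?F face_of P" "aff_dim ?F = aff_dim P - 1"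
    using facet by (auto simp: facet_defining_def facet_of_def)
  have G: "?G face_of P"
    by (rule valid_inequality_face[OF P m valid])
  have "?G \<noteq> P"
    using z by blast
  then have "aff_dim ?G < aff_dim P"
    using face_of_aff_dim_lt[OF P G] by blast
  moreover have "?F face_of ?G"
    by (rule face_of_subset[OF F(1)]) (use sub in auto)
  moreover have "?F \<noteq> ?G"
    using y \<open>l y \<noteq> \<beta>\<close> by blast
  ultimately have "aff_dim ?F < aff_dim P - 1"
    using face_of_aff_dim_lt[of ?G ?F] face_of_imp_convex[OF G] by fastforce
  then show False
    using F(2) by simp
qed

section \<open>The interval order polytope\<close>

lemma convex_interval_order_polytope: "convex interval_order_polytope"
  by (simp add: interval_order_polytope_def)

lemma char_vec_in_polytope:
  "interval_order S \<Longrightarrow> char_vec S \<in> interval_order_polytope"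
  unfolding interval_order_polytope_def by (rule hull_inc) blast

lemma char_vec_empty [simp]: "char_vec {} = 0"
  by (simp add: char_vec_def vec_eq_iff)

lemma zero_in_polytope: "0 \<in> interval_order_polytope"
  using char_vec_in_polytope[OF interval_order_empty] by simp

lemma char_vec_eq_sum:
  fixes S :: "('v::finite \<times> 'v) set"
  shows "char_vec S = (\<Sum>a\<in>S. char_vec {a})"
  by (simp add: char_vec_def vec_eq_iff)

lemma polytope_subset_convex:
  assumes "convex C" and "\<And>S. interval_order S \<Longrightarrow> char_vec S \<in> C"
  shows "interval_order_polytope \<subseteq> C"
  unfolding interval_order_polytope_def using assms by (intro hull_minimal) auto

lemma valid_on_polytopeI:
  fixes l :: "real ^ ('v::finite \<times> 'v) \<Rightarrow> real"
  assumes l: "linear l" and vert: "\<And>S. interval_order S \<Longrightarrow> l (char_vec S) \<le> \<beta>"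
    and x: "x \<in> interval_order_polytope"
  shows "l x \<le> \<beta>"
proof -
  have "convex {x. l x \<le> \<beta>}"
    by (auto simp: convex_def linear_add[OF l] linear_scale[OF l] intro: convex_bound_le)
  then show ?thesis
    using polytope_subset_convex[of "{x. l x \<le> \<beta>}"] vert x by blast
qed

lemma polytope_subset_span:
  fixes V :: "(real ^ ('v::finite \<times> 'v)) set"
  assumes "\<And>a. a \<in> arcs \<Longrightarrow> char_vec {a} \<in> span V"
  shows "interval_order_polytope \<subseteq> span V"
proof (rule polytope_subset_convex)
  show "convex (span V)"
    by (simp add: subspace_imp_convex)
  fix S :: "('v \<times> 'v) set" assume "interval_order S"
  then show "char_vec S \<in> span V"
    using interval_order_subset_arcs assms by (subst char_vec_eq_sum) (blast intro: span_sum)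
qed

lemma unit_vector_in_span:
  fixes T :: "('v::finite \<times> 'v) set"
  assumes "char_vec T \<in> span V" "a \<in> T" "\<And>b. b \<in> T \<Longrightarrow> b \<noteq> a \<Longrightarrow> char_vec {b} \<in> span V"
  shows "char_vec {a} \<in> span V"
proof -
  have "char_vec T = char_vec {a} + (\<Sum>b\<in>T - {a}. char_vec {b})"
    using assms(2) by (subst char_vec_eq_sum) (simp add: sum.remove)
  then have "char_vec {a} = char_vec T - (\<Sum>b\<in>T - {a}. char_vec {b})"
    by simp
  then show ?thesis
    using assms by (auto intro!: span_diff span_sum)
qed

lemma linear_primary_lhs: "linear (primary_lhs A B)"
  by (rule linearI) (simp_all add: primary_lhs_def sum.distrib sum_distrib_left algebra_simps)

lemma primary_lhs_char_vec:
  "primary_lhs A B (char_vec S) = real (card (A \<inter> S)) - real (card (B \<inter> S))"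
  by (simp add: primary_lhs_def char_vec_def sum.If_cases)

lemma polytope_coordinate_nonneg:
  assumes "x \<in> interval_order_polytope"
  shows "0 \<le> x $ a"
proof -
  have "linear (primary_lhs {} {a})"
    by (rule linear_primary_lhs)
  then have "primary_lhs {} {a} x \<le> 0"
    by (rule valid_on_polytopeI[OF _ _ assms]) (simp add: primary_lhs_char_vec)
  then show ?thesis
    by (simp add: primary_lhs_def)
qed

section \<open>Nonnegativity inequalities\<close>

text \<open>
  The origin and the unit vectors of all arcs other than \<open>a\<close> lie on the face, so only the unit
  vector of \<open>a\<close> has to be added to span the polytope.
\<close>

lemma nonnegativity_facet:
  fixes a :: "'v::finite \<times> 'v"
  assumes a: "a \<in> arcs"
  shows "facet_defining (primary_lhs {} {a}) 0 interval_order_polytope"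
proof (rule facet_definingI[where y = 0 and z = "char_vec {a}" and v = "char_vec {a}"])
  let ?F = "{x \<in> interval_order_polytope. primary_lhs {} {a} x = 0}"
  have "0 \<in> ?F"
    by (simp add: zero_in_polytope primary_lhs_def)
  then have hull: "affine hull insert (char_vec {a}) ?F = span (insert (char_vec {a}) ?F)"
    by (intro affine_hull_span_0 hull_inc) simp
  show "interval_order_polytope \<subseteq> affine hull insert (char_vec {a}) ?F"
    unfolding hull
  proof (rule polytope_subset_span)
    fix b :: "'v \<times> 'v" assume "b \<in> arcs"
    then have "char_vec {b} \<in> insert (char_vec {a}) ?F"
      by (cases "b = a")
         (simp_all add: char_vec_in_polytope interval_order_singleton primary_lhs_char_vec)
    then show "char_vec {b} \<in> span (insert (char_vec {a}) ?F)"
      by (rule span_base)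
  qed
next
  show "char_vec {a} \<in> interval_order_polytope"
    by (rule char_vec_in_polytope[OF interval_order_singleton[OF a]])
  show "primary_lhs {} {a} (char_vec {a}) \<noteq> 0"
    by (simp add: primary_lhs_char_vec)
qed (simp_all add: convex_interval_order_polytope linear_primary_lhs zero_in_polytope
    primary_lhs_def polytope_coordinate_nonneg)

lemma facet_with_zero_rhs:
  fixes A B :: "('v::finite \<times> 'v) set"
  assumes facet: "facet_defining (primary_lhs A B) 0 interval_order_polytope"
    and prim: "primary A B 0"
  shows "A = {}" "\<exists>b\<in>arcs. B = {b}"
proof -
  have sub: "A \<subseteq> arcs" "B \<subseteq> arcs" and disj: "A \<inter> B = {}"
    using prim by (auto simp: primary_def)
  have valid: "primary_lhs A B (char_vec S) \<le> 0" if "interval_order S" for S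
    using facet char_vec_in_polytope[OF that] by (auto simp: facet_defining_def)
  show "A = {}"
  proof (rule ccontr)
    assume "A \<noteq> {}"
    then obtain a where a: "a \<in> A" by blast
    then have "A \<inter> {a} = {a}" "B \<inter> {a} = {}"
      using disj by auto
    then show False
      using valid[OF interval_order_singleton, of a] a sub by (auto simp: primary_lhs_char_vec)
  qed
  then obtain b where b: "b \<in> B"
    using prim by (auto simp: primary_def)
  have "c = b" if c: "c \<in> B" for c
  proof (rule ccontr)
    assume "c \<noteq> b"
    \<comment> \<open>The face lies in \<open>x\<^sub>b = 0\<close>, which also contains the unit vector of \<open>c\<close>.\<close>
    have "primary_lhs A B (char_vec {c}) = 0"
    proof (rule facet_maximal[OF convex_interval_order_polytope facet,
          where m = "primary_lhs {} {b}" and \<gamma> = 0 and z = "char_vec {b}"])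
      fix x :: "real ^ ('v \<times> 'v)"
      assume x: "x \<in> interval_order_polytope" "primary_lhs A B x = 0"
      have "(\<Sum>d\<in>B. x $ d) = 0"
        using x \<open>A = {}\<close> by (simp add: primary_lhs_def)
      then show "primary_lhs {} {b} x = 0"
        using b polytope_coordinate_nonneg[OF x(1)]
        by (simp add: primary_lhs_def sum_nonneg_eq_0_iff)
    qed (use b c sub \<open>c \<noteq> b\<close> in \<open>auto simp: linear_primary_lhs char_vec_in_polytope
          interval_order_singleton primary_lhs_char_vec primary_lhs_def[of _ "{b}" "_ :: real^_"]
          polytope_coordinate_nonneg\<close>)
    then show False
      using c \<open>A = {}\<close> by (simp add: primary_lhs_char_vec)
  qed
  then show "\<exists>b\<in>arcs. B = {b}"
    using b sub by blast
qed

section \<open>Forced pairs\<close>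

text \<open>
  This formula merges C2 and C3: under C1, different arcs of \<open>A\<close> have different tails and
  different heads, so for two of them and \<open>i \<noteq> l\<close> the only coincidence left is \<open>j = k\<close>, which
  separates C3 from C2.
\<close>

definition forced :: "('v \<times> 'v) set \<Rightarrow> ('v \<times> 'v) set" where
  "forced A = {(i, l). i \<noteq> l \<and> (\<exists>j k. (i, j) \<in> A \<and> (k, l) \<in> A \<and> (i, j) \<noteq> (k, l))}"

lemma forcedI:
  "(i, j) \<in> A \<Longrightarrow> (k, l) \<in> A \<Longrightarrow> (i, j) \<noteq> (k, l) \<Longrightarrow> i \<noteq> l \<Longrightarrow> (i, l) \<in> forced A"
  unfolding forced_def by blast

lemma C1_D:
  assumes "C1 A" "(i, j) \<in> A" "(k, l) \<in> A"
  shows "i = k \<longleftrightarrow> j = l"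
  using assms unfolding C1_def by blast

lemma forced_subset_arcs: "forced A \<subseteq> arcs"
  by (auto simp: forced_def arcs_def)

lemma forced_disjoint:
  assumes "C1 A" shows "A \<inter> forced A = {}"
  using C1_D[OF assms] unfolding forced_def by fast

lemma forced_char:
  assumes A: "A \<subseteq> arcs" and C1: "C1 A"
  shows "(i, l) \<in> forced A \<longleftrightarrow>
    (\<exists>j k. (i, j) \<in> A \<and> (k, l) \<in> A \<and> distinct [i, j, k, l]) \<or>
    (\<exists>j. (i, j) \<in> A \<and> (j, l) \<in> A \<and> distinct [i, j, l])" (is "_ \<longleftrightarrow> ?R")
proof
  assume "(i, l) \<in> forced A"
  then obtain j k where *: "i \<noteq> l" "(i, j) \<in> A" "(k, l) \<in> A" "(i, j) \<noteq> (k, l)"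
    unfolding forced_def by blast
  moreover have "i \<noteq> j" "k \<noteq> l"
    using * A by (auto simp: arcs_def)
  moreover have "i \<noteq> k" "j \<noteq> l"
    using C1_D[OF C1 *(2,3)] *(4) by auto
  ultimately show ?R
    by (cases "j = k") auto
next
  assume ?R
  then show "(i, l) \<in> forced A"
    by (auto intro: forcedI)
qed

lemma forced_conditions:
  assumes A: "A \<subseteq> arcs" and C1: "C1 A"
  shows "B \<subseteq> arcs \<and> C2 A B \<and> C3 A B \<and> C2_C3_forced A B \<longleftrightarrow> B = forced A"
proof
  assume B: "B \<subseteq> arcs \<and> C2 A B \<and> C3 A B \<and> C2_C3_forced A B"
  have "(i, l) \<in> B \<longleftrightarrow> (i, l) \<in> forced A" if "(i, l) \<in> arcs" for i l
    using B that unfolding C2_C3_forced_def forced_char[OF A C1] by blast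
  then show "B = forced A"
    using B forced_subset_arcs[of A] by auto
next
  assume B: "B = forced A"
  have "C2_C3_forced A B"
    unfolding C2_C3_forced_def B using forced_char[OF A C1] by blast
  moreover have "C2 A B" "C3 A B"
    unfolding C2_def C3_def B by (auto intro: forcedI)
  ultimately show "B \<subseteq> arcs \<and> C2 A B \<and> C3 A B \<and> C2_C3_forced A B"
    using B forced_subset_arcs by blast
qed

section \<open>Inequalities with forced negative part\<close>

text \<open>
  Fix an arc \<open>p = (i, j)\<close> of \<open>A \<inter> S\<close> whose tail interval ends first. For any other arc \<open>(k, l)\<close>
  of \<open>A \<inter> S\<close>, the interval of \<open>i\<close> ends before that of \<open>l\<close> starts since that of \<open>k\<close> does. Hence
  \<open>(k, l) \<mapsto> (i, l)\<close> maps \<open>A \<inter> S - {p}\<close> into \<open>forced A \<inter> S\<close>, injectively because by C1 the head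
  determines the arc.
\<close>

lemma forced_inequality_at_order:
  fixes S :: "('v::finite \<times> 'v) set"
  assumes C1: "C1 A" and S: "interval_order S"
  shows "card (A \<inter> S) \<le> card (forced A \<inter> S) + 1"
proof (cases "A \<inter> S = {}")
  case True
  then show ?thesis by simp
next
  case False
  obtain f g :: "'v \<Rightarrow> real" where fg: "\<And>i j. (i, j) \<in> S \<longleftrightarrow> g i < f j"
    using S by (auto simp: interval_order_def)
  have irr: "(i, i) \<notin> S" for i
    using S by (auto simp: interval_order_def irrefl_def)
  obtain p where p: "p \<in> A \<inter> S" and min: "\<And>q. q \<in> A \<inter> S \<Longrightarrow> g (fst p) \<le> g (fst q)"
    using arg_min_if_finite[of "A \<inter> S" "g \<circ> fst"] False
    by (metis (no_types, lifting) comp_apply finite linorder_not_less)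
  obtain i j where p_eq: "p = (i, j)" by (cases p)
  let ?h = "\<lambda>q. (i, snd q)"
  have "inj_on ?h (A \<inter> S - {p})"
    using C1_D[OF C1] by (force simp: inj_on_def)
  moreover have "?h ` (A \<inter> S - {p}) \<subseteq> forced A \<inter> S"
  proof safe
    fix k l assume kl: "(k, l) \<in> A" "(k, l) \<in> S" "(k, l) \<noteq> p"
    have "g i \<le> g k"
      using min[of "(k, l)"] kl p_eq by simp
    then have il: "(i, l) \<in> S"
      using kl fg by force
    then show "(i, snd (k, l)) \<in> S"
      by simp
    have "i \<noteq> l"
      using il irr by blast
    then show "(i, snd (k, l)) \<in> forced A"
      using p p_eq kl by (auto intro: forcedI[of i j])
  qed
  ultimately have "card (A \<inter> S - {p}) \<le> card (forced A \<inter> S)"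
    by (intro card_inj_on_le) auto
  then show ?thesis
    using p by (simp add: card_Diff_singleton)
qed

lemma forced_inequality_valid:
  fixes A :: "('v::finite \<times> 'v) set"
  assumes "C1 A" and x: "x \<in> interval_order_polytope"
  shows "primary_lhs A (forced A) x \<le> 1"
proof -
  have "primary_lhs A (forced A) (char_vec S) \<le> 1" if "interval_order S" for S
    using forced_inequality_at_order[OF assms(1) that] by (simp add: primary_lhs_char_vec)
  then show ?thesis
    by (rule valid_on_polytopeI[OF linear_primary_lhs _ x])
qed

text \<open>
  An arc \<open>(k, l)\<close> lies in \<open>A \<union> forced A\<close> exactly if \<open>k\<close> is the tail of an arc of \<open>A\<close> and \<open>l\<close>
  is the head of one. Tight interval orders reach the arcs
  in this sequence: the arcs of \<open>A\<close> alone; the arcs with exactly one end of this kind, joined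
  with the arc of \<open>A\<close> at that end; the arcs with no such end, joined to an arc of \<open>A\<close> by a third
  arc of the preceding kind; and the forced pairs, in the staircases that force them. The bound
  on the cardinality serves only the third step, where the arc of \<open>A\<close> must not be the
  reverse of \<open>(k, l)\<close>.
\<close>

lemma tight_unit_vectors_span:
  fixes A :: "('v::finite \<times> 'v) set"
  assumes A: "A \<subseteq> arcs" and card: "2 \<le> card A" and C1: "C1 A"
    and tight: "\<And>S. interval_order S \<Longrightarrow> card (A \<inter> S) = card (forced A \<inter> S) + 1 \<Longrightarrow> char_vec S \<in> V"
    and a: "a \<in> arcs"
  shows "char_vec {a} \<in> span V"
proof -
  define N where "N = forced A"
  have disj: "A \<inter> N = {}"
    unfolding N_def by (rule forced_disjoint[OF C1])
  have neq: "i \<noteq> j" if "(i, j) \<in> A" for i j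
    using that A by (auto simp: arcs_def)
  have tight': "char_vec S \<in> span V"
    if "interval_order S" "card (A \<inter> S) = card (N \<inter> S) + 1" for S
    using that tight by (auto simp: N_def intro: span_base)
  have in_A: "char_vec {p} \<in> span V" if "p \<in> A" for p
  proof (rule tight')
    show "interval_order {p}"
      using that A interval_order_singleton by blast
    have "A \<inter> {p} = {p}" "N \<inter> {p} = {}"
      using that disj by auto
    then show "card (A \<inter> {p}) = card (N \<inter> {p}) + 1" by simp
  qed
  have free: "(k, l) \<notin> A \<union> N" if "k \<notin> fst ` A \<or> l \<notin> snd ` A" for k l
    using that by (force simp: N_def forced_def)
  have one_end: "char_vec {(k, l)} \<in> span V"
    if kl: "k \<noteq> l" and S: "p \<in> A" "interval_order {p, (k, l)}"
      and unmatched: "k \<notin> fst ` A \<or> l \<notin> snd ` A" for k l p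
  proof (rule unit_vector_in_span)
    have "A \<inter> {p, (k, l)} = {p}" "N \<inter> {p, (k, l)} = {}"
      using free[OF unmatched] S(1) disj by auto
    then show "char_vec {p, (k, l)} \<in> span V"
      by (intro tight' S(2)) simp
  qed (use S(1) in_A in auto)
  have tail_free: "char_vec {(k, l)} \<in> span V" if kl: "k \<noteq> l" "k \<notin> fst ` A" "l \<in> snd ` A" for k l
  proof -
    obtain i where il: "(i, l) \<in> A"
      using kl by force
    then have "interval_order {(i, l), (k, l)}"
      using interval_order_staircase[of i l l k] neq kl by (simp add: staircase_def insert_commute)
    then show ?thesis
      using one_end il kl by blast
  qed
  have head_free: "char_vec {(k, l)} \<in> span V" if kl: "k \<noteq> l" "k \<in> fst ` A" "l \<notin> snd ` A" for k l
  proof -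
    obtain j where kj: "(k, j) \<in> A"
      using kl by force
    then have "interval_order {(k, j), (k, l)}"
      using interval_order_staircase[of k j l k] neq kl by (simp add: staircase_def insert_commute)
    then show ?thesis
      using one_end kj kl by blast
  qed
  have both_free: "char_vec {(k, l)} \<in> span V" if kl: "k \<noteq> l" "k \<notin> fst ` A" "l \<notin> snd ` A" for k l
  proof -
    have "\<not> A \<subseteq> {(l, k)}"
      using card card_mono[of "{(l, k)}" A] by auto
    then obtain i j where ij: "(i, j) \<in> A" "(i, j) \<noteq> (l, k)"
      by auto
    have [simp]: "i \<noteq> j" by (rule neq[OF ij(1)])
    have i: "i \<in> fst ` A" and j: "j \<in> snd ` A"
      using ij(1) by force+
    \<comment> \<open>Either \<open>(k, j)\<close> or \<open>(i, l)\<close> is an arc, and completes the two arcs to a staircase.\<close>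
    show ?thesis
    proof (cases "k = j")
      case False
      let ?T = "staircase k l i j"
      have *: "A \<inter> ?T = {(i, j)}" "N \<inter> ?T = {}"
        using ij(1) disj free[of k l] free[of k j] kl by (auto simp: staircase_def)
      then have "char_vec ?T \<in> span V"
        by (intro tight' interval_order_staircase) (use kl False in auto)
      then show ?thesis
        by (rule unit_vector_in_span)
           (use in_A[OF ij(1)] tail_free[OF False kl(2) j] in \<open>auto simp: staircase_def\<close>)
    next
      case True
      then have "i \<noteq> l"
        using ij(2) by blast
      let ?T = "staircase i j k l"
      have *: "A \<inter> ?T = {(i, j)}" "N \<inter> ?T = {}"
        using ij(1) disj free[of k l] free[of i l] kl by (auto simp: staircase_def)
      then have "char_vec ?T \<in> span V"
        by (intro tight' interval_order_staircase) (use kl \<open>i \<noteq> l\<close> in auto)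
      then show ?thesis
        by (rule unit_vector_in_span)
           (use in_A[OF ij(1)] head_free[OF \<open>i \<noteq> l\<close> i kl(3)] in \<open>auto simp: staircase_def\<close>)
    qed
  qed
  have in_N: "char_vec {p} \<in> span V" if "p \<in> N" for p
  proof -
    obtain i j k l where p: "p = (i, l)" and *: "i \<noteq> l" "(i, j) \<in> A" "(k, l) \<in> A" "(i, j) \<noteq> (k, l)"
      using \<open>p \<in> N\<close> unfolding N_def forced_def by blast
    let ?T = "staircase i j k l"
    have "A \<inter> ?T = {(i, j), (k, l)}" "N \<inter> ?T = {(i, l)}"
      using * disj \<open>p \<in> N\<close> p by (auto simp: staircase_def)
    then have "char_vec ?T \<in> span V"
      using * neq by (intro tight' interval_order_staircase) auto
    then show ?thesis
      unfolding p by (rule unit_vector_in_span) (use * in_A in \<open>auto simp: staircase_def\<close>)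
  qed
  obtain k l where kl: "a = (k, l)" "k \<noteq> l"
    using a by (auto simp: arcs_def)
  show ?thesis
  proof (cases "k \<in> fst ` A \<and> l \<in> snd ` A")
    case True
    then have "a \<in> A \<union> N"
      using kl by (force simp: N_def forced_def)
    then show ?thesis
      using in_A in_N by blast
  next
    case False
    then show ?thesis
      using tail_free[of k l] head_free[of k l] both_free[of k l] kl by auto
  qed
qed

lemma forced_inequality_facet:
  fixes A :: "('v::finite \<times> 'v) set"
  assumes A: "A \<subseteq> arcs" and card: "2 \<le> card A" and C1: "C1 A"
  shows "facet_defining (primary_lhs A (forced A)) 1 interval_order_polytope"
proof -
  let ?F = "{x \<in> interval_order_polytope. primary_lhs A (forced A) x = 1}"
  have "A \<noteq> {}"
    using card by auto
  then obtain a where a: "a \<in> A"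
    by blast
  have "A \<inter> {a} = {a}" "forced A \<inter> {a} = {}"
    using a forced_disjoint[OF C1] by auto
  then have "primary_lhs A (forced A) (char_vec {a}) = 1"
    by (simp add: primary_lhs_char_vec)
  moreover have "char_vec {a} \<in> interval_order_polytope"
    using a A by (blast intro: char_vec_in_polytope interval_order_singleton)
  moreover have "interval_order_polytope \<subseteq> affine hull insert 0 ?F"
  proof -
    have "char_vec {b} \<in> span ?F" if "b \<in> arcs" for b
    proof (rule tight_unit_vectors_span[OF A card C1 _ that])
      fix S :: "('v \<times> 'v) set"
      assume "interval_order S" "card (A \<inter> S) = card (forced A \<inter> S) + 1"
      then show "char_vec S \<in> ?F"
        by (simp add: char_vec_in_polytope primary_lhs_char_vec)
    qed
    then have "interval_order_polytope \<subseteq> span ?F"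
      by (rule polytope_subset_span)
    then show ?thesis
      by (simp add: affine_hull_span_0 hull_inc span_insert_0)
  qed
  ultimately show ?thesis
    by (intro facet_definingI[where y = "char_vec {a}" and z = 0 and v = 0])
       (simp_all add: convex_interval_order_polytope linear_primary_lhs
         forced_inequality_valid[OF C1] zero_in_polytope linear_0)
qed

text \<open>
  C1 and \<open>forced A \<subseteq> B\<close> need only validity at staircases. The other two conclusions are not
  consequences of validity: they come from the maximality of facets.
\<close>

lemma facet_with_unit_rhs:
  fixes A B :: "('v::finite \<times> 'v) set"
  assumes facet: "facet_defining (primary_lhs A B) 1 interval_order_polytope"
    and prim: "primary A B 1"
  shows "C1 A" "B = forced A" "2 \<le> card A"
proof -
  have sub: "A \<subseteq> arcs" "B \<subseteq> arcs" and disj: "A \<inter> B = {}"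
    using prim by (auto simp: primary_def)
  have neq: "i \<noteq> j" if "(i, j) \<in> A" for i j
    using that sub by (auto simp: arcs_def)
  have valid: "card (A \<inter> S) \<le> card (B \<inter> S) + 1" if "interval_order S" for S
  proof -
    have "primary_lhs A B (char_vec S) \<le> 1"
      using facet char_vec_in_polytope[OF that] by (auto simp: facet_defining_def)
    then show ?thesis by (simp add: primary_lhs_char_vec)
  qed
  have stair: "(i, l) \<in> B"
    if *: "(i, j) \<in> A" "(k, l) \<in> A" "(i, j) \<noteq> (k, l)" "i \<noteq> l" for i j k l
  proof (rule ccontr)
    let ?T = "staircase i j k l"
    assume "(i, l) \<notin> B"
    then have B: "B \<inter> ?T = {}"
      using * disj by (auto simp: staircase_def)
    have "card {(i, j), (k, l)} \<le> card (A \<inter> ?T)"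
      using * by (intro card_mono) (auto simp: staircase_def)
    moreover have "interval_order ?T"
      using * neq by (intro interval_order_staircase) auto
    ultimately show False
      using valid[of ?T] B * by simp
  qed
  \<comment> \<open>Two arcs of \<open>A\<close> with a common tail or head would put one of them into \<open>B\<close>.\<close>
  show C1: "C1 A"
    unfolding C1_def
  proof (intro allI impI)
    fix i j k l assume *: "(i, j) \<in> A \<and> (k, l) \<in> A \<and> (i, j) \<noteq> (k, l)"
    then show "i \<noteq> k \<and> j \<noteq> l"
      using stair[of i j k l] neq disj by blast
  qed
  have forced_sub: "forced A \<subseteq> B"
    using stair unfolding forced_def by blast
  have lhs_forced: "primary_lhs A (forced A) x = primary_lhs A B x + (\<Sum>b\<in>B - forced A. x $ b)" for x
    using sum.subset_diff[OF forced_sub, of "\<lambda>b. x $ b"] by (simp add: primary_lhs_def)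
  show B: "B = forced A"
  proof (rule ccontr)
    assume "B \<noteq> forced A"
    then obtain b where b: "b \<in> B - forced A"
      using forced_sub by blast
    \<comment> \<open>The face lies in \<open>x\<^sub>b = 0\<close>, which contains the origin.\<close>
    have "primary_lhs A B 0 = 1"
    proof (rule facet_maximal[OF convex_interval_order_polytope facet,
          where m = "primary_lhs {} {b}" and \<gamma> = 0 and z = "char_vec {b}"])
      fix x :: "real ^ ('v \<times> 'v)"
      assume x: "x \<in> interval_order_polytope" "primary_lhs A B x = 1"
      have "(\<Sum>d\<in>B - forced A. x $ d) \<le> 0"
        using forced_inequality_valid[OF C1 x(1)] x(2) lhs_forced[of x] by simp
      moreover have "x $ b \<le> (\<Sum>d\<in>B - forced A. x $ d)"
        using polytope_coordinate_nonneg[OF x(1)] b by (intro member_le_sum) auto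
      ultimately show "primary_lhs {} {b} x = 0"
        using polytope_coordinate_nonneg[OF x(1), of b] by (simp add: primary_lhs_def)
    next
      show "char_vec {b} \<in> interval_order_polytope"
        using b sub by (blast intro: char_vec_in_polytope interval_order_singleton)
      show "primary_lhs {} {b} (char_vec {b}) \<noteq> 0"
        by (simp add: primary_lhs_char_vec)
    qed (simp_all add: linear_primary_lhs zero_in_polytope primary_lhs_def
        polytope_coordinate_nonneg)
    then show False
      by (simp add: primary_lhs_def)
  qed
  show "2 \<le> card A"
  proof (rule ccontr)
    assume "\<not> 2 \<le> card A"
    moreover have "A \<noteq> {}"
      using B prim by (auto simp: primary_def forced_def)
    then have "card A \<noteq> 0"
      by simp
    ultimately have "card A = 1"
      by linarith
    then obtain i j where A_eq: "A = {(i, j)}"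
      by (metis card_1_singletonE surj_pair)
    have "i \<noteq> j"
      using neq A_eq by blast
    have "B = {}"
      unfolding B A_eq forced_def by auto
    let ?Q = "{(i, j), (j, i)}"
    have Q: "C1 ?Q" "?Q \<subseteq> arcs" "forced ?Q = {}" "card ?Q = 2"
      using \<open>i \<noteq> j\<close> by (auto simp: C1_def arcs_def forced_def)
    have lhs_Q: "primary_lhs ?Q {} x = x $ (i, j) + x $ (j, i)" for x
      using \<open>i \<noteq> j\<close> by (simp add: primary_lhs_def)
    have validQ: "primary_lhs ?Q {} x \<le> 1" if "x \<in> interval_order_polytope" for x
      using forced_inequality_valid[OF Q(1) that] Q(3) by simp
    have arc: "interval_order {(j, i)}"
      using Q(2) by (blast intro: interval_order_singleton)
    \<comment> \<open>The face \<open>x\<^sub>i\<^sub>j = 1\<close> lies in \<open>x\<^sub>i\<^sub>j + x\<^sub>j\<^sub>i = 1\<close>, which contains the unit vector of \<open>(j, i)\<close>.\<close>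
    have "primary_lhs A B (char_vec {(j, i)}) = 1"
    proof (rule facet_maximal[OF convex_interval_order_polytope facet,
          where m = "primary_lhs ?Q {}" and \<gamma> = 1 and z = 0])
      fix x :: "real ^ ('v \<times> 'v)"
      assume x: "x \<in> interval_order_polytope" "primary_lhs A B x = 1"
      then have "x $ (i, j) = 1"
        by (simp add: A_eq \<open>B = {}\<close> primary_lhs_def)
      then show "primary_lhs ?Q {} x = 1"
        using validQ[OF x(1)] polytope_coordinate_nonneg[OF x(1), of "(j, i)"] by (simp add: lhs_Q)
    next
      show "primary_lhs ?Q {} (char_vec {(j, i)}) = 1"
        using \<open>i \<noteq> j\<close> by (simp add: lhs_Q char_vec_def)
    qed (use arc in \<open>simp_all add: validQ[unfolded lhs_Q] linear_primary_lhs zero_in_polytope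
          char_vec_in_polytope lhs_Q\<close>)
    then show False
      using \<open>i \<noteq> j\<close> by (simp add: A_eq \<open>B = {}\<close> primary_lhs_char_vec)
  qed
qed

theorem theorem8:
  assumes "CARD('v::finite) \<ge> 2"
  shows
    "{(A, B, \<beta>). primary A B \<beta> \<and>
        facet_defining (primary_lhs A B) \<beta> (interval_order_polytope :: (real ^ ('v \<times> 'v)) set)}
     = {({}, {(i, j)}, 0) | i j. (i, j) \<in> arcs}
       \<union> {(A, B, 1) | A B. A \<subseteq> arcs \<and> B \<subseteq> arcs \<and> A \<inter> B = {} \<and> card A \<ge> 2 \<and>
            C1 A \<and> C2 A B \<and> C3 A B \<and> C2_C3_forced A B}"
    (is "?facets = ?nonneg \<union> ?forced")
proof (intro equalityI subsetI)
  fix t assume "t \<in> ?facets"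
  then obtain A B \<beta> where t: "t = (A, B, \<beta>)" and prim: "primary A B \<beta>"
    and facet: "facet_defining (primary_lhs A B) \<beta> (interval_order_polytope :: (real ^ ('v \<times> 'v)) set)"
    by auto
  have "primary_lhs A B 0 \<le> \<beta>"
    using facet zero_in_polytope by (auto simp: facet_defining_def)
  then have "\<beta> \<noteq> -1"
    by (auto simp: primary_lhs_def)
  then consider "\<beta> = 0" | "\<beta> = 1"
    using prim by (auto simp: primary_def)
  then show "t \<in> ?nonneg \<union> ?forced"
  proof cases
    case 1
    then show ?thesis
      using facet_with_zero_rhs[of A B] facet prim t by auto
  next
    case 2
    then have "C1 A" "B = forced A" "2 \<le> card A"
      using facet_with_unit_rhs[of A B] facet prim by auto
    moreover have "A \<subseteq> arcs" "A \<inter> B = {}"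
      using prim by (auto simp: primary_def)
    ultimately have "t \<in> ?forced"
      using forced_conditions[of A B] t 2 by auto
    then show ?thesis by blast
  qed
next
  fix t assume "t \<in> ?nonneg \<union> ?forced"
  then show "t \<in> ?facets"
  proof
    assume "t \<in> ?nonneg"
    then show ?thesis
      using nonnegativity_facet by (auto simp: primary_def)
  next
    assume "t \<in> ?forced"
    then obtain A B where t: "t = (A, B, 1)" and AB: "A \<subseteq> arcs" "A \<inter> B = {}" "2 \<le> card A" "C1 A"
      and "B \<subseteq> arcs \<and> C2 A B \<and> C3 A B \<and> C2_C3_forced A B"
      by blast
    then have B: "B = forced A"
      using forced_conditions[of A B] by blast
    have "A \<noteq> {}"
      using AB(3) by auto
    then have "primary A B 1"
      using AB B forced_subset_arcs by (auto simp: primary_def)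
    then show ?thesis
      using forced_inequality_facet[OF AB(1,3,4)] t B by simp
  qed
qed

end
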